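(* Let $a<b$ and $c<d$ be real numbers, let $\Delta=[a,b]\times[c,d]$, and suppose that $f:\Delta\to\mathbb{R}$ is Wright-quasi-convex on the co-ordinates on $\Delta$. If $f_x\in L_1[c,d]$ and $f_y\in L_1[a,b]$ (for $x\in[a,b]$, $y\in[c,d]$), then $$\frac{1}{(b-a)(d-c)}\int_c^d\int_a^b f(x,y)\,dx\,dy\le\frac12\left[\max\left\{\frac{1}{b-a}\int_a^b f(x,c)\,dx,\ \frac{1}{b-a}\int_a^b f(x,d)\,dx\right\}+\max\left\{\frac{1}{d-c}\int_c^d f(a,y)\,dy,\ \frac{1}{d-c}\int_c^d f(b,y)\,dy\right\}\right].$$
   Context: A function $f:\Delta=[a,b]\times[c,d]\to\mathbb{R}$ is said to be Wright-quasi-convex on the co-ordinates on $\Delta$ if $$\frac12\left[f(tx+(1-t)z,\,ty+(1-t)w)+f((1-t)x+tz,\,(1-t)y+tw)\right]\le\max\{f(x,y),f(z,w)\}$$ holds for all $(x,y),(z,w)\in\Delta$ and $t\in[0,1]$. The partial mappings of $f$ are $f_y:[a,b]\to\mathbb{R}$, $f_y(u)=f(u,y)$ for $y\in[c,d]$, and $f_x:[c,d]\to\mathbb{R}$, $f_x(v)=f(x,v)$ for $x\in[a,b]$.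
   Formalization: The formal theorem additionally assumes that the outer integral on the left exists (the map y ↦ ∫_a^b f(x,y) dx is in L_1[c,d]); the stated hypotheses do not imply this, and without it the double integral can diverge to −∞. *)

theory Defs
  imports "HOL-Analysis.Analysis"
begin

text \<open>
  The inequality is required jointly, for arbitrary pairs of points of the rectangle
  (not merely for each partial mapping). Only points of the rectangle occur in it, so
  the values of \<open>f\<close> elsewhere are irrelevant.
\<close>

definition wright_quasi_convex_coords ::
  "real \<Rightarrow> real \<Rightarrow> real \<Rightarrow> real \<Rightarrow> (real \<times> real \<Rightarrow> real) \<Rightarrow> bool" where
  "wright_quasi_convex_coords a b c d f \<longleftrightarrow>
    (\<forall>x y z w t. (x, y) \<in> {a..b} \<times> {c..d} \<longrightarrow> (z, w) \<in> {a..b} \<times> {c..d} \<longrightarrow> t \<in> {0..1} \<longrightarrow>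
      1 / 2 * (f (t * x + (1 - t) * z, t * y + (1 - t) * w)
             + f ((1 - t) * x + t * z, (1 - t) * y + t * w))
      \<le> max (f (x, y)) (f (z, w)))"

end

theory Submission
  imports Defs
begin

text \<open>
  Write \<open>\<Delta> = [a,b] \<times> [c,d]\<close>. Suppose first that \<open>f\<close> attains its infimum over \<open>\<Delta>\<close> at a point
  \<open>T = (X, Y)\<close> and is quasi-convex. Join \<open>T\<close> to the boundary: every \<open>p \<in> \<Delta>\<close> other than \<open>T\<close> lies on
  a segment from \<open>T\<close> to a boundary point \<open>q\<close>, and \<open>f p \<le> max (f T) (f q) = f q\<close>. The rays cut
  \<open>\<Delta>\<close> into four triangles with apex \<open>T\<close>, one on each side, and the function that is constant
  \<open>f q\<close> along each ray integrates over a triangle to half the height times the integral of \<open>f\<close>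
  over the side. The height over the side \<open>x = b\<close> is \<open>b - X\<close>, and so on, hence
  \<open>2 \<integral>\<integral>f \<le> (X - a) \<integral>f(a,y)dy + (b - X) \<integral>f(b,y)dy + (Y - c) \<integral>f(x,c)dx + (d - Y) \<integral>f(x,d)dx\<close>.
  Two opposite heights add up to the length of \<open>\<Delta>\<close> in that direction, so each pair of terms is at
  most that length times the larger of its two integrals; this is the claim. The position of
  \<open>T\<close> disappears from the final bound, and only then.

  In general there is no minimum, and the infimum may even be \<open>-\<infinity>\<close>. The same argument with
  \<open>max f m\<close> on the sides, for any \<open>m \<ge> f T\<close>, gives \<open>double_integral_le_weighted_sides\<close>. Points
  \<open>T\<close> with \<open>f T\<close> close to the infimum (\<open>near_infimum_point\<close>) turn \<open>max f m\<close> into \<open>f\<close> in the limit,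
  by dominated convergence (\<open>cutoff_integral\<close>).

  It remains to get quasi-convexity from the Wright condition, which by itself admits
  non-measurable examples such as discontinuous additive functions. On horizontal and vertical
  segments \<open>f\<close> is measurable, and there the Wright condition does imply quasi-convexity
  (\<open>wright_measurable_imp_quasi_convex\<close>). Nothing is known about measurability along oblique
  segments, so the inequality \<open>f p \<le> max (f T) (f q)\<close> is not obtained for all \<open>p\<close>.
  Instead \<open>quasi_convex_ray_bound\<close> combines midpoint quasi-convexity in the plane with
  quasi-convexity of the sections and gives the inequality for all but countably many
  directions of the ray. A line parallel to an axis that avoids \<open>T\<close> meets these in a
  countable set, which is enough for the iterated integral of \<open>f\<close>. Fubini's theorem is
  applied only to the explicit majorant, which is a Borel function; \<open>f\<close> itself need not be jointly
  measurable.
\<close>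

section \<open>Midpoint-closed sets\<close>

definition midpoint_closed :: "'a::real_vector set \<Rightarrow> bool" where
  "midpoint_closed S \<longleftrightarrow> (\<forall>p\<in>S. \<forall>q\<in>S. midpoint p q \<in> S)"

lemma midpoint_closed_dyadic:
  assumes S: "midpoint_closed S" and "p \<in> S" "q \<in> S" and "k \<le> (2::nat) ^ n"
  shows "p + (real k / 2 ^ n) *\<^sub>R (q - p) \<in> S"
  using \<open>k \<le> 2 ^ n\<close>
proof (induction n arbitrary: k)
  case 0
  then consider "k = 0" | "k = 1" by fastforce
  then show ?case using \<open>p \<in> S\<close> \<open>q \<in> S\<close> by cases auto
next
  case (Suc n)
  define i j where "i = k div 2" and "j = (k + 1) div 2"
  have "i \<le> 2 ^ n" "j \<le> 2 ^ n" and k: "k = i + j"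
    using Suc.prems by (auto simp: i_def j_def)
  then have "midpoint (p + (real i / 2 ^ n) *\<^sub>R (q - p)) (p + (real j / 2 ^ n) *\<^sub>R (q - p)) \<in> S"
    using S Suc.IH unfolding midpoint_closed_def by blast
  moreover have "midpoint (p + (real i / 2 ^ n) *\<^sub>R (q - p)) (p + (real j / 2 ^ n) *\<^sub>R (q - p))
      = p + (real k / 2 ^ Suc n) *\<^sub>R (q - p)"
  proof -
    have "midpoint (p + s *\<^sub>R (q - p)) (p + t *\<^sub>R (q - p)) = p + ((s + t) / 2) *\<^sub>R (q - p)" for s t
      by (simp add: midpoint_def algebra_simps flip: scaleR_left_distrib)
    then show ?thesis by (simp add: k add_divide_distrib)
  qed
  ultimately show ?case by simp
qed

lemma dyadic_bracket:
  fixes s :: real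
  assumes "0 < s" "s < 1" "0 < e"
  obtains k n :: nat where "k < 2 ^ n" "real k / 2 ^ n \<le> s" "s \<le> real (Suc k) / 2 ^ n"
    "s - real k / 2 ^ n < e" "real (Suc k) / 2 ^ n - s < e"
proof -
  obtain n where n: "(1 / 2) ^ n < e"
    using real_arch_pow_inv[OF \<open>0 < e\<close>, of "1/2"] by auto
  define k where "k = nat \<lfloor>s * 2 ^ n\<rfloor>"
  have k: "real k = \<lfloor>s * 2 ^ n\<rfloor>" using \<open>0 < s\<close> by (simp add: k_def)
  then have 1: "real k \<le> s * 2 ^ n" "s * 2 ^ n < real k + 1" by linarith+
  then have "real k < 2 ^ n"
    using \<open>s < 1\<close> by (smt (verit) mult_less_cancel_right_disj mult_cancel_right1 zero_less_power)
  then have "k < 2 ^ n" by (metis of_nat_less_iff of_nat_numeral of_nat_power)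
  moreover have lo: "real k / 2 ^ n \<le> s" and hi: "s \<le> real (Suc k) / 2 ^ n"
    using 1 by (auto simp: field_simps)
  moreover have "real (Suc k) / 2 ^ n = real k / 2 ^ n + (1/2) ^ n"
    by (simp add: field_simps power_one_over)
  ultimately show thesis using that n by force
qed

text \<open>
  The midpoints reach only dyadic parameters on a segment. Here the segment is replaced by the
  triangle over a short vertical base around \<open>v\<close>: a point at parameter \<open>s\<close> lies, in its own row,
  between two points whose parameters are dyadic and close to \<open>s\<close> and whose rays still end on the
  base. Convexity of the rows then fills the gap. The base must extend to both sides of \<open>v\<close>,
  since the two rays pass on different sides of it.
\<close>

lemma midpoint_closed_triangle:
  fixes S :: "(real \<times> real) set"
  assumes S: "midpoint_closed S"
    and rows: "\<And>x1 x x2 y. (x1, y) \<in> S \<Longrightarrow> (x2, y) \<in> S \<Longrightarrow> x1 \<le> x \<Longrightarrow> x \<le> x2 \<Longrightarrow> (x, y) \<in> S"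
    and apex: "(X, Y) \<in> S"
    and base: "eventually (\<lambda>w. (\<beta>, w) \<in> S) (nhds v)"
    and s: "0 < s" "s < 1"
  shows "(X + s * (\<beta> - X), Y + s * (v - Y)) \<in> S"
proof -
  \<comment> \<open>The ray through height \<open>Y + s * (v - Y)\<close> at parameter \<open>t\<close> meets the base at height \<open>h t\<close>.\<close>
  define h where "h t = Y + s * (v - Y) / t" for t
  have "(h \<longlongrightarrow> h s) (at s)"
    unfolding h_def using s by (intro tendsto_intros) auto
  then have "(h \<longlongrightarrow> v) (nhds s)"
    using s by (simp add: tendsto_at_iff_tendsto_nhds) (simp add: h_def)
  then have "eventually (\<lambda>t. (\<beta>, h t) \<in> S \<and> t > 0) (nhds s)"
    using base s by (auto simp: filterlim_iff intro!: eventually_conj eventually_nhds_in_open[of "{0<..}", simplified])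
  then obtain e where "e > 0" and e: "\<And>t. \<bar>t - s\<bar> < e \<Longrightarrow> (\<beta>, h t) \<in> S \<and> t > 0"
    by (auto simp: eventually_nhds_metric dist_real_def)
  have hit: "(X + t * (\<beta> - X), Y + s * (v - Y)) \<in> S"
    if "t = real k / 2 ^ n" "k \<le> 2 ^ n" "\<bar>t - s\<bar> < e" for t k n
  proof -
    have "(X, Y) + t *\<^sub>R ((\<beta>, h t) - (X, Y)) \<in> S"
      using midpoint_closed_dyadic[OF S apex, of "(\<beta>, h t)"] e that by blast
    moreover have "Y + t * (h t - Y) = Y + s * (v - Y)"
      using e[OF that(3)] by (simp add: h_def)
    ultimately show ?thesis by simp
  qed
  obtain k n where kn: "k < 2 ^ n" "real k / 2 ^ n \<le> s" "s \<le> real (Suc k) / 2 ^ n"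
    "s - real k / 2 ^ n < e" "real (Suc k) / 2 ^ n - s < e"
    using dyadic_bracket[OF s \<open>e > 0\<close>] .
  define t1 t2 where "t1 = real k / 2 ^ n" and "t2 = real (Suc k) / 2 ^ n"
  have 1: "(X + t1 * (\<beta> - X), Y + s * (v - Y)) \<in> S"
    using kn by (intro hit[of _ k n]) (auto simp: t1_def)
  have 2: "(X + t2 * (\<beta> - X), Y + s * (v - Y)) \<in> S"
    using kn by (intro hit[of _ "Suc k" n]) (auto simp: t2_def)
  have t: "t1 \<le> s" "s \<le> t2" using kn by (auto simp: t1_def t2_def)
  show ?thesis
  proof (cases "X \<le> \<beta>")
    case True
    with t show ?thesis by (intro rows[OF 1 2]) (auto intro!: mult_right_mono)
  next
    case False
    with t show ?thesis by (intro rows[OF 2 1]) (auto intro!: mult_right_mono_neg)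
  qed
qed

section \<open>Wright's condition on the line\<close>

text \<open>
  Non-overlapping intervals of total length at most \<open>\<bar>S\<bar> + e\<close> cover \<open>S\<close>. As \<open>S\<close> fills at most half of
  each of them, \<open>\<bar>S\<bar> \<le> (\<bar>S\<bar> + e) / 2\<close> for every \<open>e > 0\<close>.
\<close>

lemma null_if_half_dense:
  fixes S :: "real set"
  assumes S: "S \<in> lmeasurable" "S \<subseteq> {l..u}"
    and half: "\<And>p q. l \<le> p \<Longrightarrow> p \<le> q \<Longrightarrow> q \<le> u \<Longrightarrow> measure lebesgue (S \<inter> {p..q}) \<le> (q - p) / 2"
  shows "measure lebesgue S = 0"
proof -
  have "measure lebesgue S \<le> e" if e: "e > 0" for e
  proof -
    obtain D where D: "countable D" "\<And>K. K \<in> D \<Longrightarrow> K \<subseteq> cbox l u \<and> K \<noteq> {} \<and> (\<exists>p q. K = cbox p q)"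
      "pairwise (\<lambda>A B. interior A \<inter> interior B = {}) D"
      "S \<subseteq> \<Union>D" "\<Union>D \<in> lmeasurable" "measure lebesgue (\<Union>D) \<le> measure lebesgue S + e"
      by (rule measurable_outer_intervals_bounded[OF S(1) S(2)[folded cbox_interval] e]) blast
    note cells = D(2)[unfolded cbox_interval]
    \<comment> \<open>The intervals may share endpoints; these countably many points are discarded.\<close>
    define F where "F = (\<Union>K\<in>D. K - interior K)"
    have "countable F"
      unfolding F_def
    proof (intro countable_UN D(1))
      fix K assume "K \<in> D"
      then obtain p q where "K = {p..q}" using cells by blast
      then have "K - interior K \<subseteq> {p, q}" by auto
      then show "countable (K - interior K)" by (meson countable_finite finite.simps finite_subset)
    qed
    then have "F \<in> null_sets lebesgue"
      using countable_imp_null_set_lborel null_sets_completionI by blast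
    have disj: "disjoint_family_on (\<lambda>K. S \<inter> interior K) D" "disjoint_family_on interior D"
      using D(3) by (auto simp: pairwise_def disjoint_family_on_def)
    have "emeasure lebesgue S \<le> emeasure lebesgue ((\<Union>K\<in>D. S \<inter> interior K) \<union> F)"
    proof (rule emeasure_mono)
      show "S \<subseteq> (\<Union>K\<in>D. S \<inter> interior K) \<union> F"
        using D(4) by (auto simp: F_def)
      show "(\<Union>K\<in>D. S \<inter> interior K) \<union> F \<in> sets lebesgue"
        using S(1) D(1) \<open>F \<in> null_sets lebesgue\<close>
        by (intro sets.Un sets.countable_UN') (auto intro!: sets.Int)
    qed
    also have "\<dots> = emeasure lebesgue (\<Union>K\<in>D. S \<inter> interior K)"
      using S(1) D(1) \<open>F \<in> null_sets lebesgue\<close>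
      by (intro emeasure_Un_null_set sets.countable_UN') (auto intro!: sets.Int)
    also have "\<dots> = (\<integral>\<^sup>+K. emeasure lebesgue (S \<inter> interior K) \<partial>count_space D)"
      using S(1) D(1) disj by (intro emeasure_UN_countable) (auto intro!: sets.Int)
    also have "\<dots> \<le> (\<integral>\<^sup>+K. ennreal (1/2) * emeasure lebesgue (interior K) \<partial>count_space D)"
    proof (rule nn_integral_mono)
      fix K assume "K \<in> space (count_space D)"
      then have KD: "K \<subseteq> {l..u} \<and> K \<noteq> {} \<and> (\<exists>p q. K = {p..q})" by (intro cells) simp
      then obtain p q where K: "K = {p..q}" by blast
      with KD have "{p..q} \<subseteq> {l..u}" "{p..q} \<noteq> {}" by blast+
      then have pq: "l \<le> p" "p \<le> q" "q \<le> u" by auto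
      have "emeasure lebesgue (S \<inter> interior K) \<le> emeasure lebesgue (S \<inter> {p..q})"
        using S(1) K by (intro emeasure_mono) auto
      also have "\<dots> = ennreal (measure lebesgue (S \<inter> {p..q}))"
        using S(1) by (intro emeasure_eq_measure2 fmeasurable.Int) auto
      also have "\<dots> \<le> ennreal ((q - p) / 2)"
        using half[OF pq] by (rule ennreal_leI)
      also have "(q - p) / 2 = 1 / 2 * (q - p)" by simp
      also have "ennreal (1 / 2 * (q - p)) = ennreal (1/2) * ennreal (q - p)"
        using pq by (intro ennreal_mult) auto
      also have "ennreal (q - p) = emeasure lebesgue (interior K)"
        using K pq by simp
      finally show "emeasure lebesgue (S \<inter> interior K) \<le> ennreal (1/2) * emeasure lebesgue (interior K)" .
    qed
    also have "\<dots> = ennreal (1/2) * emeasure lebesgue (\<Union>K\<in>D. interior K)"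
      using D(1) disj by (subst emeasure_UN_countable) (auto simp: nn_integral_cmult)
    also have "\<dots> \<le> ennreal (1/2) * emeasure lebesgue (\<Union>D)"
      using D(5) interior_subset by (intro mult_left_mono emeasure_mono) auto
    also have "\<dots> \<le> ennreal ((measure lebesgue S + e) / 2)"
    proof -
      have "ennreal (1/2) * emeasure lebesgue (\<Union>D) = ennreal (1 / 2 * measure lebesgue (\<Union>D))"
        using D(5) by (subst ennreal_mult) (simp_all add: emeasure_eq_measure2)
      also have "\<dots> \<le> ennreal ((measure lebesgue S + e) / 2)"
        using D(6) by (intro ennreal_leI) simp
      finally show ?thesis .
    qed
    finally have "ennreal (measure lebesgue S) \<le> ennreal ((measure lebesgue S + e) / 2)"
      by (simp only: emeasure_eq_measure2[OF S(1)])
    moreover have "0 \<le> (measure lebesgue S + e) / 2" using e by simp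
    ultimately have "measure lebesgue S \<le> (measure lebesgue S + e) / 2"
      by (simp only: ennreal_le_iff)
    then show ?thesis by argo
  qed
  then have "measure lebesgue S \<le> 0" by (rule field_le_epsilon) simp
  then show ?thesis using measure_nonneg[of lebesgue S] by linarith
qed

lemma lmeasurable_reflect:
  fixes A :: "real set"
  assumes "A \<in> lmeasurable"
  shows "(\<lambda>x. c - x) ` A \<in> lmeasurable"
    and "measure lebesgue ((\<lambda>x. c - x) ` A) = measure lebesgue A"
proof -
  have im: "(\<lambda>x. c - x) ` A = (\<lambda>x. - 1 *\<^sub>R x + c) ` A" by auto
  have "(\<lambda>x. c - x) \<in> lebesgue \<rightarrow>\<^sub>M lebesgue"
    using lebesgue_affine_measurable[where c = "\<lambda>_::real. -1" and t = c] by simp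
  then have "(\<lambda>x. c - x) -` A \<inter> space lebesgue \<in> sets lebesgue"
    using assms by (intro measurable_sets) auto
  moreover have "(\<lambda>x. c - x) -` A \<inter> space lebesgue = (\<lambda>x. c - x) ` A"
    by (auto intro!: image_eqI[of _ _ "c - _"])
  ultimately have "(\<lambda>x. c - x) ` A \<in> sets lebesgue" by simp
  moreover have "emeasure lebesgue ((\<lambda>x. c - x) ` A) = emeasure lebesgue A"
    unfolding im by (subst emeasure_lebesgue_affine) simp
  ultimately show "(\<lambda>x. c - x) ` A \<in> lmeasurable"
    using assms unfolding fmeasurable_def by (simp del: emeasure_completion)
  show "measure lebesgue ((\<lambda>x. c - x) ` A) = measure lebesgue A"
    unfolding im by (subst measure_lebesgue_affine) simp
qed

lemma reflect_midpoint: "u + v - midpoint u v = midpoint u v" for u v :: real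
  by (simp add: midpoint_def field_simps)

lemma midpoint_between:
  fixes u v :: real
  assumes "u \<le> v"
  shows "u \<le> midpoint u v" "midpoint u v \<le> v"
  using assms by (simp_all add: midpoint_def)

text \<open>
  Suppose \<open>g z > \<sigma> = max (g x) (g y)\<close> for some \<open>z\<close> between \<open>x\<close> and \<open>y\<close>, and let \<open>S\<close> be the level set of
  \<open>\<sigma>\<close>. For \<open>u, v \<in> S\<close> and any \<open>p\<close> between them the Wright condition puts \<open>p\<close> or its mirror image
  \<open>u + v - p\<close> into \<open>S\<close>, so \<open>S\<close> fills at least half of \<open>[u,v]\<close>; as \<open>S\<close> is dense in \<open>[x,y]\<close>, it
  fills at least half of every subinterval. On the other hand \<open>z\<close> is the midpoint of
  \<open>p\<close> and \<open>2 * z - p\<close>, so these two are never both in \<open>S\<close>, and a subinterval and its mirror image in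
  \<open>z\<close> have together at most half of their points in \<open>S\<close>. Hence \<open>S\<close> fills exactly half of every
  interval near \<open>z\<close>, which no measurable set can do.
\<close>

lemma wright_measurable_imp_quasi_convex:
  fixes g :: "real \<Rightarrow> real"
  assumes W: "\<And>u v t. u \<in> {a..b} \<Longrightarrow> v \<in> {a..b} \<Longrightarrow> t \<in> {0..1} \<Longrightarrow>
      1 / 2 * (g (t * u + (1 - t) * v) + g ((1 - t) * u + t * v)) \<le> max (g u) (g v)"
    and meas: "\<And>\<sigma>. {u \<in> {a..b}. g u \<le> \<sigma>} \<in> sets lebesgue"
    and ord: "a \<le> x" "x \<le> z" "z \<le> y" "y \<le> b"
  shows "g z \<le> max (g x) (g y)"
proof (rule ccontr)
  assume neg: "\<not> g z \<le> max (g x) (g y)"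
  then have xz: "x < z" "z < y" using ord by (auto simp: less_le)
  define \<sigma> where "\<sigma> = max (g x) (g y)"
  define S where "S = {u \<in> {x..y}. g u \<le> \<sigma>}"
  have ends: "x \<in> S" "y \<in> S" and z: "g z > \<sigma>" using neg xz by (auto simp: S_def \<sigma>_def)
  have Smeas: "S \<inter> {p..q} \<in> lmeasurable" for p q
  proof -
    have "S \<inter> {p..q} = {u \<in> {a..b}. g u \<le> \<sigma>} \<inter> ({x..y} \<inter> {p..q})" using ord by (auto simp: S_def)
    then have "S \<inter> {p..q} \<in> sets lebesgue" using meas[of \<sigma>] by auto
    then show ?thesis by (rule fmeasurableI2[of "{x..y}", rotated 2]) (auto simp: S_def)
  qed
  have W': "g p + g (u + v - p) \<le> 2 * max (g u) (g v)"
    if "u \<in> {x..y}" "v \<in> {x..y}" "u \<le> p" "p \<le> v" for u v p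
  proof (cases "u = v")
    case False
    define t where "t = (v - p) / (v - u)"
    have "t \<in> {0..1}" using that False by (auto simp: t_def field_simps)
    have "t * (v - u) = v - p" using False that by (simp add: t_def)
    then have eqs: "t * u + (1 - t) * v = p" "(1 - t) * u + t * v = u + v - p"
      by (auto simp: algebra_simps)
    have "u \<in> {a..b}" "v \<in> {a..b}" using that ord by auto
    from W[OF this \<open>t \<in> {0..1}\<close>] have "1 / 2 * (g p + g (u + v - p)) \<le> max (g u) (g v)"
      unfolding eqs .
    then show ?thesis by simp
  next
    case True
    with that have "p = v" by simp
    with True show ?thesis by simp
  qed
  have "midpoint_closed S"
    unfolding midpoint_closed_def
  proof (intro ballI)
    fix p q assume pq: "p \<in> S" "q \<in> S"
    have *: "midpoint u v \<in> S" if uv: "u \<le> v" "u \<in> S" "v \<in> S" for u v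
    proof -
      have range: "u \<in> {x..y}" "v \<in> {x..y}" and low: "max (g u) (g v) \<le> \<sigma>"
        using uv by (simp_all add: S_def)
      note mid = midpoint_between[OF uv(1)]
      have "g (midpoint u v) \<le> max (g u) (g v)"
        using W'[OF range mid] unfolding reflect_midpoint by simp
      moreover have "midpoint u v \<in> {x..y}"
        using range mid unfolding atLeastAtMost_iff by (blast intro: order_trans)
      ultimately show ?thesis
        using low unfolding S_def by (blast intro: order_trans)
    qed
    show "midpoint p q \<in> S"
      using *[of p q] *[of q p] pq by (cases "p \<le> q") (auto simp: midpoint_sym)
  qed
  have dense: "\<exists>u\<in>S. p < u \<and> u < q" if "x \<le> p" "p < q" "q \<le> y" for p q
  proof -
    define s where "s = ((p + q) / 2 - x) / (y - x)"
    define e where "e = ((q - p) / 2) / (y - x)"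
    have "0 < s" "s < 1" "0 < e" using that xz by (auto simp: s_def e_def field_simps)
    then obtain k n :: nat where kn: "k < 2 ^ n" "real k / 2 ^ n \<le> s" "s \<le> real (Suc k) / 2 ^ n"
        "s - real k / 2 ^ n < e" "real (Suc k) / 2 ^ n - s < e"
      by (rule dyadic_bracket)
    have yx: "y - x \<noteq> 0" using xz by simp
    have sy: "s * (y - x) = (p + q) / 2 - x" and ey: "e * (y - x) = (q - p) / 2"
      by (rule nonzero_eq_divide_eq[OF yx, THEN iffD1, OF s_def] nonzero_eq_divide_eq[OF yx, THEN iffD1, OF e_def])+
    define r where "r = real k / 2 ^ n"
    have inS: "x + r * (y - x) \<in> S"
      using midpoint_closed_dyadic[OF \<open>midpoint_closed S\<close> ends, of k n] kn(1) by (simp add: r_def)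
    have "r * (y - x) \<le> s * (y - x)"
      by (rule mult_right_mono) (use kn xz in \<open>simp_all add: r_def\<close>)
    moreover have "(s - r) * (y - x) < e * (y - x)"
      by (rule mult_strict_right_mono) (use kn xz in \<open>simp_all add: r_def\<close>)
    ultimately have "p < x + r * (y - x)" "x + r * (y - x) < q"
      using that unfolding left_diff_distrib[of s r] sy ey by argo+
    with inS show ?thesis by blast
  qed
  have half_ends: "(v - u) / 2 \<le> measure lebesgue (S \<inter> {u..v})" if "u \<in> S" "v \<in> S" "u \<le> v" for u v
  proof -
    let ?A = "S \<inter> {u..v}" and ?B = "(\<lambda>p. (u + v) - p) ` (S \<inter> {u..v})"
    have "p \<in> ?A \<union> ?B" if p: "p \<in> {u..v}" for p
    proof -
      have "g p + g (u + v - p) \<le> 2 * \<sigma>"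
        using W'[of u v p] p \<open>u \<in> S\<close> \<open>v \<in> S\<close> by (auto simp: S_def)
      then consider "g p \<le> \<sigma>" | "g (u + v - p) \<le> \<sigma>" by linarith
      then show ?thesis
      proof cases
        case 1 then show ?thesis using p \<open>u \<in> S\<close> \<open>v \<in> S\<close> by (auto simp: S_def)
      next
        case 2
        then have "u + v - p \<in> ?A" using p \<open>u \<in> S\<close> \<open>v \<in> S\<close> by (auto simp: S_def)
        then have "u + v - (u + v - p) \<in> ?B" by (rule imageI)
        moreover have "u + v - (u + v - p) = p" by simp
        ultimately show ?thesis by simp
      qed
    qed
    then have cover: "{u..v} \<subseteq> ?A \<union> ?B" by (rule subsetI)
    have A: "?A \<in> lmeasurable" and B: "?B \<in> lmeasurable"
      by (rule Smeas, rule lmeasurable_reflect(1)[OF Smeas])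
    have "measure lebesgue {u..v} \<le> measure lebesgue (?A \<union> ?B)"
      using cover by (rule measure_mono_fmeasurable) (simp_all add: fmeasurable.Un[OF A B])
    also have "\<dots> \<le> measure lebesgue ?A + measure lebesgue ?B"
      using A B by (intro measure_Un_le fmeasurableD)
    also have "measure lebesgue ?B = measure lebesgue ?A"
      by (rule lmeasurable_reflect(2)[OF Smeas])
    finally show ?thesis using that by simp
  qed
  have half: "(q - p) / 2 \<le> measure lebesgue (S \<inter> {p..q})" if pq: "x \<le> p" "p \<le> q" "q \<le> y" for p q
  proof (cases "p = q")
    case False
    show ?thesis
    proof (rule field_le_epsilon)
      fix e :: real assume "e > 0"
      define d where "d = min e ((q - p) / 2)"
      have "p < q" using that False by simp
      then have d: "d > 0" "d \<le> e" using \<open>e > 0\<close> by (simp_all add: d_def)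
      have "d \<le> (q - p) / 2" unfolding d_def by (rule min.cobounded2)
      then have pd: "p + d \<le> q - d" by argo
      from pd d have "p + d \<le> y" "x \<le> q - d" "p < p + d" "q - d < q" using that by linarith+
      obtain u where u: "u \<in> S" "p < u" "u < p + d" using dense[of p "p + d"] pq(1) \<open>p < p + d\<close> \<open>p + d \<le> y\<close> by blast
      obtain v where v: "v \<in> S" "q - d < v" "v < q" using dense[of "q - d" q] pq(3) \<open>q - d < q\<close> \<open>x \<le> q - d\<close> by blast
      have "u \<le> v" using u v pd by linarith
      have "(q - p) / 2 - e \<le> (v - u) / 2" using u v d by argo
      also have "\<dots> \<le> measure lebesgue (S \<inter> {u..v})" using u v \<open>u \<le> v\<close> by (intro half_ends)
      also have "\<dots> \<le> measure lebesgue (S \<inter> {p..q})"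
        by (rule measure_mono_fmeasurable[OF _ fmeasurableD[OF Smeas] Smeas]) (use u v in auto)
      finally show "(q - p) / 2 \<le> measure lebesgue (S \<inter> {p..q}) + e" by (simp only: diff_le_eq)
    qed
  qed simp
  \<comment> \<open>The reflection in \<open>z\<close> maps \<open>[z,w]\<close> into \<open>[x,y]\<close>.\<close>
  define w where "w = min y (2 * z - x)"
  have w: "z < w" "w \<le> y" "x \<le> 2 * z - w" using xz by (auto simp: w_def min_def)
  have "measure lebesgue (S \<inter> {z..w}) = 0"
  proof (rule null_if_half_dense[of _ z w])
    show "S \<inter> {z..w} \<in> lmeasurable" by (rule Smeas)
    show "S \<inter> {z..w} \<subseteq> {z..w}" by simp
  next
    fix p q assume pq: "z \<le> p" "p \<le> q" "q \<le> w"
    let ?A = "S \<inter> {p..q}" and ?B = "(\<lambda>u. 2 * z - u) ` (S \<inter> {2 * z - q..2 * z - p})"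
    have "?A \<inter> ?B = {}"
    proof (rule ccontr)
      assume "?A \<inter> ?B \<noteq> {}"
      then obtain u where u: "u \<in> S" "2 * z - u \<in> S" by force
      then have "g z + g (u + (2 * z - u) - z) \<le> 2 * max (g u) (g (2 * z - u))"
      proof (cases "u \<le> z")
        case True then show ?thesis using u by (intro W') (auto simp: S_def)
      next
        case False
        then have "g z + g ((2 * z - u) + u - z) \<le> 2 * max (g (2 * z - u)) (g u)"
          using u by (intro W') (auto simp: S_def)
        then show ?thesis by (simp add: max.commute)
      qed
      then show False using u z by (auto simp: S_def)
    qed
    moreover have A: "?A \<in> lmeasurable" and B: "?B \<in> lmeasurable"
      by (rule Smeas, rule lmeasurable_reflect(1)[OF Smeas])
    ultimately have "measure lebesgue ?A + measure lebesgue ?B = measure lebesgue (?A \<union> ?B)"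
      using measure_Un3[OF A B] by simp
    also have "\<dots> \<le> measure lebesgue {p..q}"
      by (rule measure_mono_fmeasurable) (auto intro!: sets.Un fmeasurableD A B)
    also have "\<dots> = q - p" using pq by simp
    finally have "measure lebesgue ?A + measure lebesgue (S \<inter> {2 * z - q..2 * z - p}) \<le> q - p"
      by (simp only: lmeasurable_reflect(2)[OF Smeas])
    moreover have "(2 * z - p - (2 * z - q)) / 2 \<le> measure lebesgue (S \<inter> {2 * z - q..2 * z - p})"
      by (rule half) (use pq w xz in linarith)+
    ultimately have "measure lebesgue ?A \<le> (q - p) / 2"
      by argo
    moreover have "S \<inter> {z..w} \<inter> {p..q} = ?A" using pq by auto
    ultimately show "measure lebesgue (S \<inter> {z..w} \<inter> {p..q}) \<le> (q - p) / 2" by simp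
  qed
  moreover have "(w - z) / 2 \<le> measure lebesgue (S \<inter> {z..w})"
    by (rule half) (use w xz in linarith)+
  ultimately show False using w(1) by argo
qed

section \<open>Functions that are constant along rays from a point\<close>

text \<open>
  The extension of \<open>g\<close>, a function on the vertical line through \<open>(\<beta>, 0)\<close>, to the strip between the
  lines \<open>x = X\<close> and \<open>x = \<beta>\<close> that is constant on the rays from \<open>(X, Y)\<close>.
\<close>

definition fan :: "real \<Rightarrow> real \<Rightarrow> real \<Rightarrow> (real \<Rightarrow> ennreal) \<Rightarrow> real \<Rightarrow> real \<Rightarrow> ennreal" where
  "fan X Y \<beta> g x y = indicator (open_segment X \<beta>) x * g (Y + (y - Y) * (\<beta> - X) / (x - X))"

lemma open_segment_borel [measurable]: "open_segment X \<beta> \<in> sets borel" for X \<beta> :: real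
  by (simp add: open_segment_eq_real_ivl)

lemma fan_measurable [measurable (raw)]:
  assumes [measurable]: "g \<in> borel_measurable borel" "p \<in> borel_measurable M" "q \<in> borel_measurable M"
  shows "(\<lambda>z. fan X Y \<beta> g (p z) (q z)) \<in> borel_measurable M"
  unfolding fan_def by measurable

lemma nn_integral_parameter_over_segment:
  fixes X \<beta> :: real
  shows "(\<integral>\<^sup>+x. indicator (open_segment X \<beta>) x * ennreal ((x - X) / (\<beta> - X)) \<partial>lborel) = ennreal (\<bar>\<beta> - X\<bar> / 2)"
proof (cases "\<beta> = X")
  case False
  have seg: "X + (\<beta> - X) * s \<in> open_segment X \<beta> \<longleftrightarrow> 0 < s \<and> s < 1" for s
  proof -
    have "X + (\<beta> - X) * s = (1 - u) *\<^sub>R X + u *\<^sub>R \<beta> \<longleftrightarrow> (\<beta> - X) * s = (\<beta> - X) * u" for u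
      by (auto simp: algebra_simps)
    then show ?thesis using False by (auto simp: in_segment)
  qed
  have "(\<integral>\<^sup>+x. indicator (open_segment X \<beta>) x * ennreal ((x - X) / (\<beta> - X)) \<partial>lborel)
      = ennreal \<bar>\<beta> - X\<bar> * (\<integral>\<^sup>+s. indicator (open_segment X \<beta>) (X + (\<beta> - X) * s) * ennreal ((X + (\<beta> - X) * s - X) / (\<beta> - X)) \<partial>lborel)"
    using False by (intro nn_integral_real_affine) auto
  also have "(\<integral>\<^sup>+s. indicator (open_segment X \<beta>) (X + (\<beta> - X) * s) * ennreal ((X + (\<beta> - X) * s - X) / (\<beta> - X)) \<partial>lborel)
      = (\<integral>\<^sup>+s. ennreal s * indicator {0..1} s \<partial>lborel)"
  proof (rule nn_integral_cong_AE)
    have "AE s in lborel. s \<noteq> (1::real)" by (rule AE_lborel_singleton)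
    then show "AE s in lborel. indicator (open_segment X \<beta>) (X + (\<beta> - X) * s) * ennreal ((X + (\<beta> - X) * s - X) / (\<beta> - X))
        = ennreal s * indicator {0..1} s"
    proof eventually_elim
      case (elim s)
      then show ?case using False by (auto simp: seg indicator_def)
    qed
  qed
  also have "\<dots> = ennreal (1\<^sup>2 / 2 - 0\<^sup>2 / 2)"
    by (rule nn_integral_FTC_Icc) (auto intro!: derivative_eq_intros)
  also have "ennreal \<bar>\<beta> - X\<bar> * ennreal (1\<^sup>2 / 2 - 0\<^sup>2 / 2) = ennreal (\<bar>\<beta> - X\<bar> * (1 / 2))"
    by (subst ennreal_mult) simp_all
  finally show ?thesis by simp
qed simp

text \<open>
  At abscissa \<open>x\<close> the extension is a copy of \<open>g\<close> shrunk by the factor \<open>(x - X) / (\<beta> - X)\<close>, and this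
  factor integrates to half the distance of the two lines.
\<close>

lemma nn_integral_fan:
  assumes [measurable]: "g \<in> borel_measurable borel"
  shows "(\<integral>\<^sup>+x. \<integral>\<^sup>+y. fan X Y \<beta> g x y \<partial>lborel \<partial>lborel) = ennreal (\<bar>\<beta> - X\<bar> / 2) * (\<integral>\<^sup>+v. g v \<partial>lborel)"
proof -
  have "(\<integral>\<^sup>+y. fan X Y \<beta> g x y \<partial>lborel)
      = indicator (open_segment X \<beta>) x * ennreal ((x - X) / (\<beta> - X)) * (\<integral>\<^sup>+v. g v \<partial>lborel)" for x
  proof (cases "x \<in> open_segment X \<beta>")
    case True
    define r where "r = (x - X) / (\<beta> - X)"
    have r: "r > 0" and x: "x \<noteq> X" and b: "\<beta> \<noteq> X"
      using True by (auto simp: r_def open_segment_eq_real_ivl zero_less_divide_iff split: if_splits)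
    have inverse: "Y + (Y - r * Y + r * v - Y) * (\<beta> - X) / (x - X) = v" for v
    proof -
      have "(Y - r * Y + r * v - Y) * (\<beta> - X) / (x - X) = (v - Y) * (r * ((\<beta> - X) / (x - X)))"
        by (simp add: algebra_simps)
      also have "r * ((\<beta> - X) / (x - X)) = 1" using x b by (simp add: r_def)
      finally show ?thesis by simp
    qed
    have "(\<integral>\<^sup>+y. g (Y + (y - Y) * (\<beta> - X) / (x - X)) \<partial>lborel)
        = ennreal \<bar>r\<bar> * (\<integral>\<^sup>+v. g (Y + (Y - r * Y + r * v - Y) * (\<beta> - X) / (x - X)) \<partial>lborel)"
      using r by (intro nn_integral_real_affine) auto
    then show ?thesis using True r unfolding inverse by (simp add: fan_def flip: r_def)
  qed (simp add: fan_def)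
  then have "(\<integral>\<^sup>+x. \<integral>\<^sup>+y. fan X Y \<beta> g x y \<partial>lborel \<partial>lborel)
      = (\<integral>\<^sup>+x. indicator (open_segment X \<beta>) x * ennreal ((x - X) / (\<beta> - X)) \<partial>lborel) * (\<integral>\<^sup>+v. g v \<partial>lborel)"
    by (simp add: nn_integral_multc)
  then show ?thesis by (simp only: nn_integral_parameter_over_segment)
qed

lemma nn_integral_fan_swapped:
  assumes [measurable]: "g \<in> borel_measurable borel"
  shows "(\<integral>\<^sup>+y. \<integral>\<^sup>+x. fan X Y \<beta> g x y \<partial>lborel \<partial>lborel) = ennreal (\<bar>\<beta> - X\<bar> / 2) * (\<integral>\<^sup>+v. g v \<partial>lborel)"
proof -
  have "(\<integral>\<^sup>+y. \<integral>\<^sup>+x. fan X Y \<beta> g x y \<partial>lborel \<partial>lborel) = (\<integral>\<^sup>+x. \<integral>\<^sup>+y. fan X Y \<beta> g x y \<partial>lborel \<partial>lborel)"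
    by (rule lborel_pair.Fubini') measurable
  then show ?thesis by (simp only: nn_integral_fan[OF assms])
qed

section \<open>Quasi-convexity along rays\<close>

text \<open>
  The part of quasi-convexity that the Wright condition and measurable sections provide: midpoints
  in all directions, but whole segments only parallel to the axes.
\<close>

definition sectionally_quasi_convex :: "real \<Rightarrow> real \<Rightarrow> real \<Rightarrow> real \<Rightarrow> (real \<times> real \<Rightarrow> real) \<Rightarrow> bool" where
  "sectionally_quasi_convex a b c d f \<longleftrightarrow>
    (\<forall>p\<in>{a..b} \<times> {c..d}. \<forall>q\<in>{a..b} \<times> {c..d}. f (midpoint p q) \<le> max (f p) (f q)) \<and>
    (\<forall>y\<in>{c..d}. \<forall>u v w. a \<le> u \<longrightarrow> u \<le> v \<longrightarrow> v \<le> w \<longrightarrow> w \<le> b \<longrightarrow> f (v, y) \<le> max (f (u, y)) (f (w, y))) \<and>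
    (\<forall>x\<in>{a..b}. \<forall>u v w. c \<le> u \<longrightarrow> u \<le> v \<longrightarrow> v \<le> w \<longrightarrow> w \<le> d \<longrightarrow> f (x, v) \<le> max (f (x, u)) (f (x, w)))"

lemma midpoint_Pair: "midpoint (x, y) (z, w) = (midpoint x z, midpoint y w)"
  by (simp add: midpoint_def)

lemma sectionally_quasi_convex_swap:
  assumes "sectionally_quasi_convex a b c d f"
  shows "sectionally_quasi_convex c d a b (\<lambda>(y, x). f (x, y))"
  using assms unfolding sectionally_quasi_convex_def by (fastforce simp: midpoint_Pair)

lemma sectionally_quasi_convex_level_midpoint_closed:
  assumes "sectionally_quasi_convex a b c d f"
  shows "midpoint_closed {p \<in> {a..b} \<times> {c..d}. f p \<le> \<tau>}"
proof -
  have "convex ({a..b} \<times> {c..d})" by (intro convex_Times convex_real_interval)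
  then have rect: "midpoint p q \<in> {a..b} \<times> {c..d}" if "p \<in> {a..b} \<times> {c..d}" "q \<in> {a..b} \<times> {c..d}" for p q
    using closed_segment_subset[OF that] midpoint_in_closed_segment by blast
  have "f (midpoint p q) \<le> max (f p) (f q)" if "p \<in> {a..b} \<times> {c..d}" "q \<in> {a..b} \<times> {c..d}" for p q
    using assms that unfolding sectionally_quasi_convex_def by blast
  note mid = this
  show ?thesis
    unfolding midpoint_closed_def
  proof (intro ballI CollectI conjI)
    fix p q assume p: "p \<in> {p \<in> {a..b} \<times> {c..d}. f p \<le> \<tau>}" and q: "q \<in> {p \<in> {a..b} \<times> {c..d}. f p \<le> \<tau>}"
    then show "midpoint p q \<in> {a..b} \<times> {c..d}" by (intro rect) simp_all
    have "f (midpoint p q) \<le> max (f p) (f q)" using p q by (intro mid) simp_all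
    also have "\<dots> \<le> \<tau>" using p q by simp
    finally show "f (midpoint p q) \<le> \<tau>" .
  qed
qed

text \<open>
  The points that belong to a sublevel set of rational height without being interior to it. If
  \<open>v\<close> is not such a point and \<open>\<sigma> > h v\<close> is rational, then \<open>h \<le> \<sigma>\<close> on a neighbourhood of \<open>v\<close>. Rational
  heights keep the set countable.
\<close>

definition level_ends :: "(real \<Rightarrow> real) \<Rightarrow> real \<Rightarrow> real \<Rightarrow> real set" where
  "level_ends h c d = (\<Union>\<sigma>\<in>\<rat>. {v \<in> {c..d}. h v \<le> \<sigma>} - interior {v \<in> {c..d}. h v \<le> \<sigma>})"

lemma is_interval_level:
  fixes h :: "real \<Rightarrow> real"
  assumes "\<And>u v w. c \<le> u \<Longrightarrow> u \<le> v \<Longrightarrow> v \<le> w \<Longrightarrow> w \<le> d \<Longrightarrow> h v \<le> max (h u) (h w)"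
  shows "is_interval {v \<in> {c..d}. h v \<le> \<sigma>}"
  unfolding is_interval_1
proof (intro allI impI ballI)
  fix u w v assume "u \<in> {v \<in> {c..d}. h v \<le> \<sigma>}" "w \<in> {v \<in> {c..d}. h v \<le> \<sigma>}" "u \<le> v \<and> v \<le> w"
  then show "v \<in> {v \<in> {c..d}. h v \<le> \<sigma>}"
    using assms[of u v w] by (auto simp: max_def split: if_splits)
qed

lemma countable_interval_minus_interior:
  fixes S :: "real set"
  assumes "is_interval S"
  shows "countable (S - interior S)"
proof -
  have "S - interior S \<subseteq> {Inf S, Sup S}"
  proof
    fix v assume v: "v \<in> S - interior S"
    have "(\<forall>u\<in>S. v \<le> u) \<or> (\<forall>w\<in>S. w \<le> v)"
    proof (rule ccontr)
      assume "\<not> ?thesis"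
      then obtain u w where uw: "u \<in> S" "w \<in> S" "u < v" "v < w" by (auto simp: not_le)
      then have "{u<..<w} \<subseteq> S"
        using assms unfolding is_interval_1 by (meson greaterThanLessThan_iff less_imp_le subsetI)
      then have "v \<in> interior S" using uw by (intro interiorI[of "{u<..<w}"]) auto
      with v show False by blast
    qed
    then show "v \<in> {Inf S, Sup S}"
      using v cInf_eq_minimum[of v S] cSup_eq_maximum[of v S] by auto
  qed
  then show ?thesis by (meson countable_finite finite.simps finite_subset)
qed

lemma countable_level_ends:
  fixes h :: "real \<Rightarrow> real"
  assumes "\<And>u v w. c \<le> u \<Longrightarrow> u \<le> v \<Longrightarrow> v \<le> w \<Longrightarrow> w \<le> d \<Longrightarrow> h v \<le> max (h u) (h w)"
  shows "countable (level_ends h c d)"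
  unfolding level_ends_def
  by (intro countable_UN countable_rat countable_interval_minus_interior is_interval_level assms)

text \<open>
  For rational \<open>\<sigma> > f (\<beta>, v)\<close> the sublevel set of height \<open>max m \<sigma>\<close> contains the apex and a short
  vertical base around \<open>(\<beta>, v)\<close>, hence the open segment between them, by
  \<open>midpoint_closed_triangle\<close>.
\<close>

lemma quasi_convex_ray_bound:
  assumes f: "sectionally_quasi_convex a b c d f"
    and X: "X \<in> {a..b}" and Y: "Y \<in> {c..d}" and \<beta>: "\<beta> \<in> {a..b}" and v: "v \<in> {c..d}"
    and m: "f (X, Y) \<le> m"
    and v_gen: "v \<notin> level_ends (\<lambda>v. f (\<beta>, v)) c d"
    and s: "0 < s" "s < 1"
  shows "f (X + s * (\<beta> - X), Y + s * (v - Y)) \<le> max m (f (\<beta>, v))"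
proof (rule ccontr)
  assume "\<not> ?thesis"
  then obtain \<sigma> where \<sigma>: "\<sigma> \<in> \<rat>" "f (\<beta>, v) < \<sigma>" "\<sigma> < f (X + s * (\<beta> - X), Y + s * (v - Y))"
    and m_less: "m < f (X + s * (\<beta> - X), Y + s * (v - Y))"
    using Rats_dense_in_real by (metis max_less_iff_conj not_le)
  define S where "S = {p \<in> {a..b} \<times> {c..d}. f p \<le> max m \<sigma>}"
  have "v \<in> interior {w \<in> {c..d}. f (\<beta>, w) \<le> \<sigma>}"
    using v_gen \<sigma> v unfolding level_ends_def by force
  then have "eventually (\<lambda>w. w \<in> interior {w \<in> {c..d}. f (\<beta>, w) \<le> \<sigma>}) (nhds v)"
    by (intro eventually_nhds_in_open) auto
  then have base: "eventually (\<lambda>w. (\<beta>, w) \<in> S) (nhds v)"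
  proof eventually_elim
    case (elim w)
    then show ?case using interior_subset \<beta> by (force simp: S_def)
  qed
  have "(X + s * (\<beta> - X), Y + s * (v - Y)) \<in> S"
  proof (rule midpoint_closed_triangle[OF _ _ _ base s])
    show "midpoint_closed S"
      unfolding S_def by (rule sectionally_quasi_convex_level_midpoint_closed[OF f])
    show "(X, Y) \<in> S" using X Y m by (auto simp: S_def)
    fix x1 x x2 y assume 1: "(x1, y) \<in> S" "(x2, y) \<in> S" "x1 \<le> x" "x \<le> x2"
    then have "f (x, y) \<le> max (f (x1, y)) (f (x2, y))"
      using f unfolding sectionally_quasi_convex_def S_def by auto
    with 1 show "(x, y) \<in> S" by (auto simp: S_def)
  qed
  then show False using \<sigma> m_less by (auto simp: S_def)
qed

definition side_excess :: "(real \<Rightarrow> real) \<Rightarrow> real \<Rightarrow> real \<Rightarrow> real \<Rightarrow> real \<Rightarrow> ennreal" where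
  "side_excess h m c d v = ennreal (h v - m) * indicator {c..d} v"

text \<open>
  Sublevel sets of a quasi-convex function of one variable are intervals, so the side data are
  Borel functions and not merely Lebesgue measurable; their extensions along rays are then
  jointly Borel.
\<close>

lemma side_excess_measurable:
  fixes h :: "real \<Rightarrow> real"
  assumes "\<And>u v w. c \<le> u \<Longrightarrow> u \<le> v \<Longrightarrow> v \<le> w \<Longrightarrow> w \<le> d \<Longrightarrow> h v \<le> max (h u) (h w)"
  shows "side_excess h m c d \<in> borel_measurable borel"
proof -
  have [measurable]: "h \<in> borel_measurable (restrict_space borel {c..d})"
    unfolding borel_measurable_iff_le
  proof
    fix \<sigma>
    have "{v \<in> {c..d}. h v \<le> \<sigma>} \<in> sets borel"
      by (intro real_interval_borel_measurable is_interval_level assms)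
    then show "{v \<in> space (restrict_space borel {c..d}). h v \<le> \<sigma>} \<in> sets (restrict_space borel {c..d})"
      by (auto simp: sets_restrict_space space_restrict_space intro!: image_eqI[of _ _ "{v \<in> {c..d}. h v \<le> \<sigma>}"])
  qed
  have "(\<lambda>v. ennreal (h v - m)) \<in> borel_measurable (restrict_space borel {c..d})"
    by measurable
  then show ?thesis
    unfolding side_excess_def[abs_def] by (subst (asm) borel_measurable_restrict_space_iff_ennreal) auto
qed

lemma excess_le_fan:
  assumes f: "sectionally_quasi_convex a b c d f"
    and X: "X \<in> {a..b}" and Y: "Y \<in> {c..d}" and \<beta>: "\<beta> \<in> {a..b}"
    and m: "f (X, Y) \<le> m" and x: "x \<in> open_segment X \<beta>"
    and v: "v = Y + (y - Y) * (\<beta> - X) / (x - X)" "v \<in> {c..d}"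
    and v_gen: "v \<notin> level_ends (\<lambda>v. f (\<beta>, v)) c d"
  shows "ennreal (f (x, y) - m) \<le> fan X Y \<beta> (side_excess (\<lambda>v. f (\<beta>, v)) m c d) x y"
proof -
  define s where "s = (x - X) / (\<beta> - X)"
  have s: "0 < s" "s < 1" and ne: "x - X \<noteq> 0" "\<beta> - X \<noteq> 0"
    using x by (auto simp: s_def open_segment_eq_real_ivl divide_simps split: if_splits)
  have 1: "X + s * (\<beta> - X) = x" using ne by (simp add: s_def)
  have 2: "Y + s * (v - Y) = y" using ne by (simp add: s_def v(1))
  have "f (x, y) \<le> max m (f (\<beta>, v))"
    using quasi_convex_ray_bound[OF f X Y \<beta> v(2) m v_gen s] unfolding 1 2 .
  then have "ennreal (f (x, y) - m) \<le> ennreal (f (\<beta>, v) - m)"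
    by (cases "m \<le> f (\<beta>, v)") (auto intro!: ennreal_leI simp: ennreal_neg)
  then show ?thesis using x v by (simp add: fan_def side_excess_def)
qed

lemma between_apex_and_side:
  fixes Y \<gamma> c d r :: real
  assumes "Y \<in> {c..d}" "\<gamma> \<in> {c..d}" "0 \<le> r" "r \<le> 1"
  shows "Y + (\<gamma> - Y) * r \<in> {c..d}"
proof -
  have "(1 - r) *\<^sub>R Y + r *\<^sub>R \<gamma> \<in> {c..d}"
    using assms by (intro convexD[OF convex_real_interval(5)]) auto
  then show ?thesis by (simp add: algebra_simps)
qed

lemma pair_member_le_sum:
  fixes F :: "'a \<Rightarrow> ennreal"
  assumes "k \<in> {i, j}"
  shows "F k \<le> F i + F j"
proof (cases "k = i")
  case True
  then show ?thesis using add_left_mono[of 0 "F j" "F i"] by simp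
next
  case False
  then have "k = j" using assms by simp
  then show ?thesis using add_right_mono[of 0 "F i" "F j"] by simp
qed

text \<open>
  The relative displacements \<open>s\<close> and \<open>r\<close> of \<open>(x, y)\<close> from the apex tell where its ray leaves the
  rectangle: through a vertical side if \<open>r \<le> s\<close>, through a horizontal one otherwise. The
  term of that triangle already dominates, and the other three are nonnegative.
\<close>

lemma excess_le_four_fans:
  fixes f :: "real \<times> real \<Rightarrow> real"
  assumes f: "sectionally_quasi_convex a b c d f"
    and X: "X \<in> {a..b}" and Y: "Y \<in> {c..d}" and m: "f (X, Y) \<le> m"
    and x: "a < x" "x < b" "x \<noteq> X" and y: "c < y" "y < d" "y \<noteq> Y"
    and gen1: "\<And>\<beta>. \<beta> \<in> {a, b} \<Longrightarrow> \<beta> \<noteq> X \<Longrightarrow> Y + (y - Y) * (\<beta> - X) / (x - X) \<notin> level_ends (\<lambda>v. f (\<beta>, v)) c d"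
    and gen2: "\<And>\<gamma>. \<gamma> \<in> {c, d} \<Longrightarrow> \<gamma> \<noteq> Y \<Longrightarrow> X + (x - X) * (\<gamma> - Y) / (y - Y) \<notin> level_ends (\<lambda>u. f (u, \<gamma>)) a b"
  shows "ennreal (f (x, y) - m) \<le>
      fan X Y a (side_excess (\<lambda>v. f (a, v)) m c d) x y + fan X Y b (side_excess (\<lambda>v. f (b, v)) m c d) x y
    + (fan Y X c (side_excess (\<lambda>u. f (u, c)) m a b) y x + fan Y X d (side_excess (\<lambda>u. f (u, d)) m a b) y x)"
proof -
  define \<beta> where "\<beta> = (if X < x then b else a)"
  define \<gamma> where "\<gamma> = (if Y < y then d else c)"
  have \<beta>: "\<beta> \<in> {a, b}" "\<beta> \<in> {a..b}" "x \<in> open_segment X \<beta>" "\<beta> \<noteq> X"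
    using x X by (auto simp: \<beta>_def open_segment_eq_real_ivl)
  have \<gamma>: "\<gamma> \<in> {c, d}" "\<gamma> \<in> {c..d}" "y \<in> open_segment Y \<gamma>" "\<gamma> \<noteq> Y"
    using y Y by (auto simp: \<gamma>_def open_segment_eq_real_ivl)
  define s where "s = (x - X) / (\<beta> - X)"
  define r where "r = (y - Y) / (\<gamma> - Y)"
  have s: "0 < s" using x X by (auto simp: s_def \<beta>_def zero_less_divide_iff)
  have r: "0 < r" using y Y by (auto simp: r_def \<gamma>_def zero_less_divide_iff)
  show ?thesis
  proof (cases "r \<le> s")
    case True
    have "Y + (y - Y) * (\<beta> - X) / (x - X) = Y + (\<gamma> - Y) * (r / s)"
      using \<beta> \<gamma> x y by (simp add: r_def s_def)
    also have "\<dots> \<in> {c..d}"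
      using True r s by (intro between_apex_and_side Y \<gamma>) auto
    finally have "ennreal (f (x, y) - m) \<le> fan X Y \<beta> (side_excess (\<lambda>v. f (\<beta>, v)) m c d) x y"
      using \<beta> by (intro excess_le_fan[OF f X Y _ m _ refl] gen1)
    also have "\<dots> \<le> fan X Y a (side_excess (\<lambda>v. f (a, v)) m c d) x y + fan X Y b (side_excess (\<lambda>v. f (b, v)) m c d) x y"
      using pair_member_le_sum[OF \<beta>(1), of "\<lambda>\<beta>. fan X Y \<beta> (side_excess (\<lambda>v. f (\<beta>, v)) m c d) x y"] .
    also have "\<dots> \<le> \<dots> + (fan Y X c (side_excess (\<lambda>u. f (u, c)) m a b) y x + fan Y X d (side_excess (\<lambda>u. f (u, d)) m a b) y x)"
      by (rule add_increasing2[OF zero_le order_refl])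
    finally show ?thesis .
  next
    case False
    have "X + (x - X) * (\<gamma> - Y) / (y - Y) = X + (\<beta> - X) * (s / r)"
      using \<beta> \<gamma> x y by (simp add: r_def s_def)
    also have "\<dots> \<in> {a..b}"
      using False r s by (intro between_apex_and_side X \<beta>) auto
    finally have "ennreal ((\<lambda>(y, x). f (x, y)) (y, x) - m)
        \<le> fan Y X \<gamma> (side_excess (\<lambda>u. (\<lambda>(y, x). f (x, y)) (\<gamma>, u)) m a b) y x"
      using \<gamma> m by (intro excess_le_fan[OF sectionally_quasi_convex_swap[OF f] Y X _ _ _ refl]) (use gen2 in simp_all)
    then have "ennreal (f (x, y) - m) \<le> fan Y X \<gamma> (side_excess (\<lambda>u. f (u, \<gamma>)) m a b) y x" by simp
    also have "\<dots> \<le> fan Y X c (side_excess (\<lambda>u. f (u, c)) m a b) y x + fan Y X d (side_excess (\<lambda>u. f (u, d)) m a b) y x"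
      using pair_member_le_sum[OF \<gamma>(1), of "\<lambda>\<gamma>. fan Y X \<gamma> (side_excess (\<lambda>u. f (u, \<gamma>)) m a b) y x"] .
    also have "\<dots> \<le> fan X Y a (side_excess (\<lambda>v. f (a, v)) m c d) x y + fan X Y b (side_excess (\<lambda>v. f (b, v)) m c d) x y + \<dots>"
      by (rule add_increasing[OF zero_le order_refl])
    finally show ?thesis .
  qed
qed

section \<open>Integration over the four triangles\<close>

lemma countable_preimage_inj:
  assumes "countable N" "inj_on \<phi> A"
  shows "countable {x \<in> A. \<phi> x \<in> N}"
proof (rule countable_image_inj_on)
  show "countable (\<phi> ` {x \<in> A. \<phi> x \<in> N})" by (rule countable_subset[OF _ assms(1)]) auto
  show "inj_on \<phi> {x \<in> A. \<phi> x \<in> N}" using assms(2) by (rule inj_on_subset) auto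
qed

text \<open>
  For fixed \<open>y \<noteq> Y\<close> the end of the ray through \<open>(x, y)\<close> is an injective function of \<open>x\<close> on each side,
  so only countably many \<open>x\<close> lead to an exceptional direction and the pointwise bound holds
  almost everywhere in the row.
\<close>

lemma nn_integral_excess_le:
  fixes f :: "real \<times> real \<Rightarrow> real"
  assumes f: "sectionally_quasi_convex a b c d f"
    and X: "X \<in> {a..b}" and Y: "Y \<in> {c..d}" and m: "f (X, Y) \<le> m"
  shows "(\<integral>\<^sup>+y. (\<integral>\<^sup>+x. ennreal (f (x, y) - m) * indicator {a..b} x \<partial>lborel) * indicator {c..d} y \<partial>lborel) \<le>
      ennreal ((X - a) / 2) * (\<integral>\<^sup>+v. side_excess (\<lambda>v. f (a, v)) m c d v \<partial>lborel)
    + ennreal ((b - X) / 2) * (\<integral>\<^sup>+v. side_excess (\<lambda>v. f (b, v)) m c d v \<partial>lborel)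
    + (ennreal ((Y - c) / 2) * (\<integral>\<^sup>+u. side_excess (\<lambda>u. f (u, c)) m a b u \<partial>lborel)
     + ennreal ((d - Y) / 2) * (\<integral>\<^sup>+u. side_excess (\<lambda>u. f (u, d)) m a b u \<partial>lborel))"
proof -
  have ab: "a \<in> {a..b}" "b \<in> {a..b}" and cd: "c \<in> {c..d}" "d \<in> {c..d}" using X Y by auto
  have col: "f (x, v) \<le> max (f (x, u)) (f (x, w))" if "x \<in> {a..b}" "c \<le> u" "u \<le> v" "v \<le> w" "w \<le> d" for x u v w
    using f that unfolding sectionally_quasi_convex_def by blast
  have row: "f (v, y) \<le> max (f (u, y)) (f (w, y))" if "y \<in> {c..d}" "a \<le> u" "u \<le> v" "v \<le> w" "w \<le> b" for y u v w
    using f that unfolding sectionally_quasi_convex_def by blast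
  define V where "V \<beta> = side_excess (\<lambda>v. f (\<beta>, v)) m c d" for \<beta>
  define H where "H \<gamma> = side_excess (\<lambda>u. f (u, \<gamma>)) m a b" for \<gamma>
  have [measurable]: "V a \<in> borel_measurable borel" "V b \<in> borel_measurable borel"
    unfolding V_def using col[OF ab(1)] col[OF ab(2)] by (auto intro!: side_excess_measurable)
  have [measurable]: "H c \<in> borel_measurable borel" "H d \<in> borel_measurable borel"
    unfolding H_def using row[OF cd(1)] row[OF cd(2)] by (auto intro!: side_excess_measurable)
  let ?F = "\<lambda>x y. fan X Y a (V a) x y + fan X Y b (V b) x y + (fan Y X c (H c) y x + fan Y X d (H d) y x)"
  have row_bound: "(\<integral>\<^sup>+x. ennreal (f (x, y) - m) * indicator {a..b} x \<partial>lborel) * indicator {c..d} y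
      \<le> (\<integral>\<^sup>+x. ?F x y \<partial>lborel)" if y: "y \<noteq> Y" "y \<noteq> c" "y \<noteq> d" for y
  proof (cases "y \<in> {c..d}")
    case True
    \<comment> \<open>The abscissae in row \<open>y\<close> whose rays end at an exceptional point of a side.\<close>
    define K1 where "K1 \<beta> = {x \<in> - {X}. Y + (y - Y) * (\<beta> - X) / (x - X) \<in> level_ends (\<lambda>v. f (\<beta>, v)) c d}" for \<beta>
    define K2 where "K2 \<gamma> = {x \<in> UNIV. X + (x - X) * (\<gamma> - Y) / (y - Y) \<in> level_ends (\<lambda>u. f (u, \<gamma>)) a b}" for \<gamma>
    have K1: "countable (K1 \<beta>)" if "\<beta> \<in> {a..b}" "\<beta> \<noteq> X" for \<beta>
      unfolding K1_def
    proof (rule countable_preimage_inj)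
      show "countable (level_ends (\<lambda>v. f (\<beta>, v)) c d)" using col[OF that(1)] by (intro countable_level_ends)
      show "inj_on (\<lambda>x. Y + (y - Y) * (\<beta> - X) / (x - X)) (- {X})"
        using y that by (auto simp: inj_on_def)
    qed
    have K2: "countable (K2 \<gamma>)" if "\<gamma> \<in> {c..d}" "\<gamma> \<noteq> Y" for \<gamma>
      unfolding K2_def
    proof (rule countable_preimage_inj)
      show "countable (level_ends (\<lambda>u. f (u, \<gamma>)) a b)" using row[OF that(1)] by (intro countable_level_ends)
      show "inj_on (\<lambda>x. X + (x - X) * (\<gamma> - Y) / (y - Y)) UNIV"
        using y that by (auto simp: inj_on_def)
    qed
    define K where "K = {X, a, b} \<union> (\<Union>\<beta>\<in>{a, b} - {X}. K1 \<beta>) \<union> (\<Union>\<gamma>\<in>{c, d} - {Y}. K2 \<gamma>)"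
    have "countable K"
      unfolding K_def using ab cd by (intro countable_Un countable_UN K1 K2) auto
    then have "AE x in lborel. x \<notin> K"
      by (intro AE_not_in countable_imp_null_set_lborel)
    then have "AE x in lborel. ennreal (f (x, y) - m) * indicator {a..b} x \<le> ?F x y"
    proof eventually_elim
      case (elim x)
      show ?case
      proof (cases "x \<in> {a..b}")
        case True
        then have x: "a < x" "x < b" "x \<noteq> X" using elim by (auto simp: K_def less_le)
        have y': "c < y" "y < d" using y \<open>y \<in> {c..d}\<close> by (auto simp: less_le)
        have "ennreal (f (x, y) - m) \<le> ?F x y"
          unfolding V_def H_def
          using elim x by (intro excess_le_four_fans[OF f X Y m x y' y(1)]) (auto simp: K_def K1_def K2_def)
        then show ?thesis using True by simp
      qed simp
    qed
    then show ?thesis using True by (simp add: nn_integral_mono_AE)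
  qed simp
  have "AE y in lborel. y \<noteq> Y \<and> y \<noteq> c \<and> y \<noteq> d"
    using AE_lborel_singleton[of Y] AE_lborel_singleton[of c] AE_lborel_singleton[of d] by eventually_elim auto
  then have "(\<integral>\<^sup>+y. (\<integral>\<^sup>+x. ennreal (f (x, y) - m) * indicator {a..b} x \<partial>lborel) * indicator {c..d} y \<partial>lborel)
      \<le> (\<integral>\<^sup>+y. \<integral>\<^sup>+x. ?F x y \<partial>lborel \<partial>lborel)"
    by (intro nn_integral_mono_AE) (rule eventually_mono, assumption, rule row_bound, simp_all)
  also have "\<dots> = (\<integral>\<^sup>+y. \<integral>\<^sup>+x. fan X Y a (V a) x y \<partial>lborel \<partial>lborel) + (\<integral>\<^sup>+y. \<integral>\<^sup>+x. fan X Y b (V b) x y \<partial>lborel \<partial>lborel)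
     + ((\<integral>\<^sup>+y. \<integral>\<^sup>+x. fan Y X c (H c) y x \<partial>lborel \<partial>lborel) + (\<integral>\<^sup>+y. \<integral>\<^sup>+x. fan Y X d (H d) y x \<partial>lborel \<partial>lborel))"
    by (simp add: nn_integral_add)
  also have "\<dots> = ennreal (\<bar>a - X\<bar> / 2) * (\<integral>\<^sup>+v. V a v \<partial>lborel) + ennreal (\<bar>b - X\<bar> / 2) * (\<integral>\<^sup>+v. V b v \<partial>lborel)
    + (ennreal (\<bar>c - Y\<bar> / 2) * (\<integral>\<^sup>+u. H c u \<partial>lborel) + ennreal (\<bar>d - Y\<bar> / 2) * (\<integral>\<^sup>+u. H d u \<partial>lborel))"
    by (simp only: nn_integral_fan nn_integral_fan_swapped \<open>V a \<in> _\<close> \<open>V b \<in> _\<close> \<open>H c \<in> _\<close> \<open>H d \<in> _\<close>)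
  also have "\<bar>a - X\<bar> = X - a" using X by simp
  also have "\<bar>b - X\<bar> = b - X" using X by simp
  also have "\<bar>c - Y\<bar> = Y - c" using Y by simp
  also have "\<bar>d - Y\<bar> = d - Y" using Y by simp
  finally show ?thesis unfolding V_def H_def .
qed

lemma set_integral_le_nn_integral:
  fixes h :: "real \<Rightarrow> real"
  assumes "set_integrable lebesgue A h"
  shows "ennreal (LINT x:A|lebesgue. h x) \<le> (\<integral>\<^sup>+x. ennreal (h x) * indicator A x \<partial>lborel)"
proof -
  let ?k = "\<lambda>x. indicator A x *\<^sub>R h x"
  have k: "integrable lebesgue ?k" using assms by (simp add: set_integrable_def)
  have "ennreal (integral\<^sup>L lebesgue ?k) \<le> ennreal (\<integral>x. max 0 (?k x) \<partial>lebesgue)"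
    using k by (intro ennreal_leI integral_mono integrable_max) auto
  also have "\<dots> = (\<integral>\<^sup>+x. ennreal (max 0 (?k x)) \<partial>lebesgue)"
    using k by (intro nn_integral_eq_integral[symmetric] integrable_max) auto
  also have "\<dots> = (\<integral>\<^sup>+x. ennreal (h x) * indicator A x \<partial>lebesgue)"
    by (intro nn_integral_cong) (auto simp: indicator_def max_def ennreal_neg)
  finally show ?thesis by (simp only: set_lebesgue_integral_def nn_integral_completion)
qed

lemma set_integral_minus_const:
  fixes h :: "real \<Rightarrow> real"
  assumes "h absolutely_integrable_on {c..d}" "c \<le> d"
  shows "(\<lambda>v. h v - k) absolutely_integrable_on {c..d}"
    and "(LINT v:{c..d}|lebesgue. h v - k) = (LINT v:{c..d}|lebesgue. h v) - k * (d - c)"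
proof -
  have const: "(\<lambda>_::real. k) absolutely_integrable_on {c..d}"
    by (simp add: absolutely_integrable_on_const)
  show "(\<lambda>v. h v - k) absolutely_integrable_on {c..d}"
    using assms(1) const by (rule set_integral_diff(1))
  have "(LINT v:{c..d}|lebesgue. k) = k * (d - c)"
    using assms(2) by (simp add: set_lebesgue_integral_def)
  then show "(LINT v:{c..d}|lebesgue. h v - k) = (LINT v:{c..d}|lebesgue. h v) - k * (d - c)"
    using set_integral_diff(2)[OF assms(1) const] by simp
qed

lemma nn_integral_side_excess:
  fixes h :: "real \<Rightarrow> real"
  assumes h: "h absolutely_integrable_on {c..d}" and "c \<le> d"
  shows "(\<integral>\<^sup>+v. side_excess h m c d v \<partial>lborel) = ennreal ((LINT v:{c..d}|lebesgue. max (h v) m) - m * (d - c))"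
    and "0 \<le> (LINT v:{c..d}|lebesgue. max (h v) m) - m * (d - c)"
proof -
  have hm: "(\<lambda>v. max (h v) m) absolutely_integrable_on {c..d}"
    using h by (intro absolutely_integrable_max_1) (simp_all add: absolutely_integrable_on_const)
  note diff = set_integral_minus_const[OF hm \<open>c \<le> d\<close>, of m]
  let ?k = "\<lambda>v. indicator {c..d} v *\<^sub>R (max (h v) m - m)"
  have "(\<integral>\<^sup>+v. side_excess h m c d v \<partial>lebesgue) = (\<integral>\<^sup>+v. ennreal (?k v) \<partial>lebesgue)"
    by (intro nn_integral_cong) (auto simp: side_excess_def indicator_def max_def ennreal_neg)
  also have "\<dots> = ennreal (integral\<^sup>L lebesgue ?k)"
    using diff(1) by (intro nn_integral_eq_integral) (auto simp: set_integrable_def)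
  finally show "(\<integral>\<^sup>+v. side_excess h m c d v \<partial>lborel) = ennreal ((LINT v:{c..d}|lebesgue. max (h v) m) - m * (d - c))"
    unfolding diff(2)[symmetric] by (simp only: set_lebesgue_integral_def nn_integral_completion)
  have "0 \<le> (LINT v:{c..d}|lebesgue. max (h v) m - m)"
    unfolding set_lebesgue_integral_def by (intro integral_nonneg_AE) simp
  then show "0 \<le> (LINT v:{c..d}|lebesgue. max (h v) m) - m * (d - c)"
    unfolding diff(2) .
qed

text \<open>
  All integrals are taken of the excess over \<open>m\<close>, which makes the majorant nonnegative, so that
  nonnegative integrals need no integrability of it. The multiples of \<open>m\<close> cancel, because the
  four triangles together have the area of the rectangle.
\<close>

lemma double_integral_le_weighted_sides:
  fixes f :: "real \<times> real \<Rightarrow> real"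
  assumes f: "sectionally_quasi_convex a b c d f"
    and X: "X \<in> {a..b}" and Y: "Y \<in> {c..d}" and m: "f (X, Y) \<le> m"
    and cols: "\<And>x. x \<in> {a..b} \<Longrightarrow> (\<lambda>v. f (x, v)) absolutely_integrable_on {c..d}"
    and rows: "\<And>y. y \<in> {c..d} \<Longrightarrow> (\<lambda>u. f (u, y)) absolutely_integrable_on {a..b}"
    and outer: "(\<lambda>y. LINT x:{a..b}|lebesgue. f (x, y)) absolutely_integrable_on {c..d}"
  shows "2 * (LINT y:{c..d}|lebesgue. (LINT x:{a..b}|lebesgue. f (x, y))) \<le>
      (X - a) * (LINT v:{c..d}|lebesgue. max (f (a, v)) m) + (b - X) * (LINT v:{c..d}|lebesgue. max (f (b, v)) m)
    + ((Y - c) * (LINT u:{a..b}|lebesgue. max (f (u, c)) m) + (d - Y) * (LINT u:{a..b}|lebesgue. max (f (u, d)) m))"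
proof -
  have "a \<le> b" "c \<le> d" using X Y by auto
  then have ends: "a \<in> {a..b}" "b \<in> {a..b}" "c \<in> {c..d}" "d \<in> {c..d}" by auto
  let ?I = "\<lambda>y. LINT x:{a..b}|lebesgue. f (x, y)"
  define L where "L = (LINT y:{c..d}|lebesgue. ?I y)"
  define A where "A = (LINT v:{c..d}|lebesgue. max (f (a, v)) m)"
  define B where "B = (LINT v:{c..d}|lebesgue. max (f (b, v)) m)"
  define C where "C = (LINT u:{a..b}|lebesgue. max (f (u, c)) m)"
  define D where "D = (LINT u:{a..b}|lebesgue. max (f (u, d)) m)"
  have excess: "0 \<le> A - m * (d - c)" "0 \<le> B - m * (d - c)" "0 \<le> C - m * (b - a)" "0 \<le> D - m * (b - a)"
    unfolding A_def B_def C_def D_def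
    by (intro nn_integral_side_excess(2) cols rows ends \<open>a \<le> b\<close> \<open>c \<le> d\<close>)+
  have weights: "0 \<le> (X - a) / 2" "0 \<le> (b - X) / 2" "0 \<le> (Y - c) / 2" "0 \<le> (d - Y) / 2"
    using X Y by auto
  note outer' = set_integral_minus_const[OF outer \<open>c \<le> d\<close>, of "m * (b - a)"]
  have "ennreal (L - m * (b - a) * (d - c)) = ennreal (LINT y:{c..d}|lebesgue. ?I y - m * (b - a))"
    by (simp only: outer'(2) L_def)
  also have "\<dots> \<le> (\<integral>\<^sup>+y. ennreal (?I y - m * (b - a)) * indicator {c..d} y \<partial>lborel)"
    by (rule set_integral_le_nn_integral[OF outer'(1)])
  also have "\<dots> \<le> (\<integral>\<^sup>+y. (\<integral>\<^sup>+x. ennreal (f (x, y) - m) * indicator {a..b} x \<partial>lborel) * indicator {c..d} y \<partial>lborel)"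
  proof (rule nn_integral_mono)
    fix y :: real
    show "ennreal (?I y - m * (b - a)) * indicator {c..d} y
        \<le> (\<integral>\<^sup>+x. ennreal (f (x, y) - m) * indicator {a..b} x \<partial>lborel) * indicator {c..d} y"
    proof (cases "y \<in> {c..d}")
      case True
      note row = set_integral_minus_const[OF rows[OF True] \<open>a \<le> b\<close>, of m]
      show ?thesis
        using set_integral_le_nn_integral[OF row(1)] True unfolding row(2) by simp
    qed simp
  qed
  also have "\<dots> \<le> ennreal ((X - a) / 2) * ennreal (A - m * (d - c)) + ennreal ((b - X) / 2) * ennreal (B - m * (d - c))
      + (ennreal ((Y - c) / 2) * ennreal (C - m * (b - a)) + ennreal ((d - Y) / 2) * ennreal (D - m * (b - a)))"
    using nn_integral_excess_le[OF f X Y m] unfolding A_def B_def C_def D_def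
    by (simp only: nn_integral_side_excess(1) cols rows ends \<open>a \<le> b\<close> \<open>c \<le> d\<close>)
  also have "\<dots> = ennreal ((X - a) / 2 * (A - m * (d - c)) + (b - X) / 2 * (B - m * (d - c))
      + ((Y - c) / 2 * (C - m * (b - a)) + (d - Y) / 2 * (D - m * (b - a))))"
    by (simp only: ennreal_mult ennreal_plus add_nonneg_nonneg mult_nonneg_nonneg excess weights)
  finally have "L - m * (b - a) * (d - c) \<le> (X - a) / 2 * (A - m * (d - c)) + (b - X) / 2 * (B - m * (d - c))
      + ((Y - c) / 2 * (C - m * (b - a)) + (d - Y) / 2 * (D - m * (b - a)))"
    by (simp only: ennreal_le_iff add_nonneg_nonneg mult_nonneg_nonneg excess weights)
  then have "2 * (L - m * (b - a) * (d - c)) \<le> 2 * ((X - a) / 2 * (A - m * (d - c)) + (b - X) / 2 * (B - m * (d - c))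
      + ((Y - c) / 2 * (C - m * (b - a)) + (d - Y) / 2 * (D - m * (b - a))))"
    by (rule mult_left_mono) simp
  also have "\<dots> = (X - a) * A + (b - X) * B + ((Y - c) * C + (d - Y) * D) - 2 * (m * (b - a) * (d - c))"
    by (simp add: field_simps)
  finally show ?thesis unfolding A_def B_def C_def D_def L_def by simp
qed

section \<open>Approaching the infimum\<close>

text \<open>
  The increment \<open>1 / Suc n\<close> serves the case of a finite infimum, the floor \<open>- n\<close> that of the infimum
  \<open>-\<infinity>\<close>. With both in one function the two cases share the passage to the limit.
\<close>

definition cutoff :: "nat \<Rightarrow> real \<Rightarrow> real" where
  "cutoff n r = max (r + 1 / Suc n) (- real n)"

lemma near_infimum_point:
  fixes f :: "'a \<Rightarrow> real"
  assumes "S \<noteq> {}"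
  obtains p where "p \<in> S" "\<And>q. q \<in> S \<Longrightarrow> f p \<le> cutoff n (f q)"
proof (cases "bdd_below (f ` S)")
  case True
  have "Inf (f ` S) < Inf (f ` S) + 1 / Suc n" by simp
  then obtain p where p: "p \<in> S" "f p < Inf (f ` S) + 1 / Suc n"
    using assms cInf_lessD[of "f ` S"] by blast
  have "f p \<le> cutoff n (f q)" if "q \<in> S" for q
    using p(2) cInf_lower[OF imageI[OF that] True] by (simp add: cutoff_def)
  then show thesis using p(1) that by blast
next
  case False
  then obtain p where "p \<in> S" "f p < - real n" by (auto simp: bdd_below_def not_le)
  moreover from this have "f p \<le> cutoff n (f q)" for q by (simp add: cutoff_def)
  ultimately show thesis using that by blast
qed

lemma cutoff_integral:
  fixes h :: "real \<Rightarrow> real"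
  assumes h: "h absolutely_integrable_on {c..d}"
  shows "(\<lambda>v. cutoff n (h v)) absolutely_integrable_on {c..d}"
    and "(\<lambda>n. LINT v:{c..d}|lebesgue. cutoff n (h v)) \<longlonglongrightarrow> (LINT v:{c..d}|lebesgue. h v)"
proof -
  have const: "(\<lambda>_::real. k) absolutely_integrable_on {c..d}" for k :: real
    by (simp add: absolutely_integrable_on_const)
  show cut: "(\<lambda>v. cutoff n (h v)) absolutely_integrable_on {c..d}" for n
    unfolding cutoff_def by (intro absolutely_integrable_max_1 set_integral_add(1) h const)
  show "(\<lambda>n. LINT v:{c..d}|lebesgue. cutoff n (h v)) \<longlonglongrightarrow> (LINT v:{c..d}|lebesgue. h v)"
    unfolding set_lebesgue_integral_def
  proof (rule integral_dominated_convergence[where w = "\<lambda>v. indicator {c..d} v *\<^sub>R (\<bar>h v\<bar> + 1)"])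
    show "(\<lambda>v. indicator {c..d} v *\<^sub>R h v) \<in> borel_measurable lebesgue"
      using h unfolding set_integrable_def by (rule borel_measurable_integrable)
    show "(\<lambda>v. indicator {c..d} v *\<^sub>R cutoff n (h v)) \<in> borel_measurable lebesgue" for n
      using cut unfolding set_integrable_def by (rule borel_measurable_integrable)
    have "(\<lambda>v. \<bar>h v\<bar> + 1) absolutely_integrable_on {c..d}"
      using set_integrable_abs[OF h] const by (rule set_integral_add(1))
    then show "integrable lebesgue (\<lambda>v. indicator {c..d} v *\<^sub>R (\<bar>h v\<bar> + 1))"
      unfolding set_integrable_def .
    have "(\<lambda>n. cutoff n r) \<longlonglongrightarrow> r" for r
    proof (rule Lim_transform_eventually)
      show "(\<lambda>n. r + 1 / Suc n) \<longlonglongrightarrow> r"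
        using tendsto_add[OF tendsto_const LIMSEQ_inverse_real_of_nat, of r] by (simp add: inverse_eq_divide)
      show "eventually (\<lambda>n. r + 1 / Suc n = cutoff n r) sequentially"
        using eventually_ge_at_top[of "nat \<lceil>- r\<rceil>"]
      proof eventually_elim
        case (elim n)
        then have "- real n \<le> r" by linarith
        moreover have "0 \<le> 1 / Suc n" by simp
        ultimately have "- real n \<le> r + 1 / Suc n" by linarith
        then show ?case by (simp add: cutoff_def)
      qed
    qed
    then show "AE v in lebesgue. (\<lambda>n. indicator {c..d} v *\<^sub>R cutoff n (h v)) \<longlonglongrightarrow> indicator {c..d} v *\<^sub>R h v"
      by (intro AE_I2 tendsto_scaleR tendsto_const)
    have "\<bar>cutoff n r\<bar> \<le> \<bar>r\<bar> + 1" for n r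
    proof -
      have "0 \<le> 1 / real (Suc n)" "1 / real (Suc n) \<le> 1" by simp_all
      then show ?thesis unfolding cutoff_def by linarith
    qed
    then show "AE v in lebesgue. norm (indicator {c..d} v *\<^sub>R cutoff n (h v)) \<le> indicator {c..d} v *\<^sub>R (\<bar>h v\<bar> + 1)" for n
      by (intro AE_I2) (simp add: indicator_def)
  qed
qed

section \<open>The inequality\<close>

lemma absolutely_integrable_level_set_measurable:
  fixes g :: "real \<Rightarrow> real"
  assumes "g absolutely_integrable_on {a..b}"
  shows "{u \<in> {a..b}. g u \<le> \<sigma>} \<in> sets lebesgue"
proof -
  have [measurable]: "(\<lambda>u. indicator {a..b} u *\<^sub>R g u) \<in> borel_measurable lebesgue"
    using assms unfolding set_integrable_def by (rule borel_measurable_integrable)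
  have "{u \<in> space lebesgue. indicator {a..b} u *\<^sub>R g u \<le> \<sigma>} \<in> sets lebesgue" by measurable
  then have "{a..b} \<inter> {u \<in> space lebesgue. indicator {a..b} u *\<^sub>R g u \<le> \<sigma>} \<in> sets lebesgue" by auto
  also have "{a..b} \<inter> {u \<in> space lebesgue. indicator {a..b} u *\<^sub>R g u \<le> \<sigma>} = {u \<in> {a..b}. g u \<le> \<sigma>}" by auto
  finally show ?thesis .
qed

text \<open>
  The parameter \<open>1 / 2\<close> gives the midpoints; pairs of points with a common coordinate give the Wright
  condition for the sections, which are measurable.
\<close>

lemma wright_imp_sectionally_quasi_convex:
  assumes W: "wright_quasi_convex_coords a b c d f"
    and cols: "\<And>x. x \<in> {a..b} \<Longrightarrow> (\<lambda>v. f (x, v)) absolutely_integrable_on {c..d}"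
    and rows: "\<And>y. y \<in> {c..d} \<Longrightarrow> (\<lambda>u. f (u, y)) absolutely_integrable_on {a..b}"
  shows "sectionally_quasi_convex a b c d f"
proof -
  have wright: "1 / 2 * (f (t * x + (1 - t) * z, t * y + (1 - t) * w) + f ((1 - t) * x + t * z, (1 - t) * y + t * w))
      \<le> max (f (x, y)) (f (z, w))"
    if "x \<in> {a..b}" "y \<in> {c..d}" "z \<in> {a..b}" "w \<in> {c..d}" "t \<in> {0..1}" for x y z w t
    using W that unfolding wright_quasi_convex_coords_def by blast
  have conv: "t * y + (1 - t) * y = y" "(1 - t) * y + t * y = y" for t y :: real
    by (simp_all add: algebra_simps)
  have mid: "f (midpoint p q) \<le> max (f p) (f q)" if pq: "p \<in> {a..b} \<times> {c..d}" "q \<in> {a..b} \<times> {c..d}" for p q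
  proof -
    obtain x y z w where p: "p = (x, y)" and q: "q = (z, w)" by (metis surj_pair)
    have "midpoint p q = (1 / 2 * x + (1 - 1 / 2) * z, 1 / 2 * y + (1 - 1 / 2) * w)"
      and "midpoint p q = ((1 - 1 / 2) * x + 1 / 2 * z, (1 - 1 / 2) * y + 1 / 2 * w)"
      unfolding p q by (simp_all add: midpoint_Pair midpoint_def field_simps)
    then have "1 / 2 * (f (midpoint p q) + f (midpoint p q)) \<le> max (f p) (f q)"
      using wright[of x y z w "1 / 2"] pq unfolding p q by simp
    then show ?thesis by simp
  qed
  have "f (v, y) \<le> max (f (u, y)) (f (w, y))" if "y \<in> {c..d}" "a \<le> u" "u \<le> v" "v \<le> w" "w \<le> b" for y u v w
  proof (rule wright_measurable_imp_quasi_convex[of a b "\<lambda>x. f (x, y)"])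
    show "1 / 2 * (f (t * x + (1 - t) * z, y) + f ((1 - t) * x + t * z, y)) \<le> max (f (x, y)) (f (z, y))"
      if "x \<in> {a..b}" "z \<in> {a..b}" "t \<in> {0..1}" for x z t
      using wright[OF that(1) \<open>y \<in> _\<close> that(2) \<open>y \<in> _\<close> that(3)] unfolding conv .
  qed (use that absolutely_integrable_level_set_measurable[OF rows] in auto)
  moreover have "f (x, v) \<le> max (f (x, u)) (f (x, w))" if "x \<in> {a..b}" "c \<le> u" "u \<le> v" "v \<le> w" "w \<le> d" for x u v w
  proof (rule wright_measurable_imp_quasi_convex[of c d "\<lambda>y. f (x, y)"])
    show "1 / 2 * (f (x, t * y + (1 - t) * z) + f (x, (1 - t) * y + t * z)) \<le> max (f (x, y)) (f (x, z))"
      if "y \<in> {c..d}" "z \<in> {c..d}" "t \<in> {0..1}" for y z t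
      using wright[OF \<open>x \<in> _\<close> that(1) \<open>x \<in> _\<close> that(2,3)] unfolding conv .
  qed (use that absolutely_integrable_level_set_measurable[OF cols] in auto)
  ultimately show ?thesis using mid unfolding sectionally_quasi_convex_def by blast
qed

lemma weighted_le_max:
  fixes p q A B :: real
  assumes "0 \<le> p" "0 \<le> q"
  shows "p * A + q * B \<le> (p + q) * max A B"
proof -
  have "p * A \<le> p * max A B" "q * B \<le> q * max A B" using assms by (auto intro!: mult_left_mono)
  then show ?thesis by (simp add: distrib_right)
qed

theorem theorem7:
  fixes a b c d :: real and f :: "real \<times> real \<Rightarrow> real"
  assumes "a < b" and "c < d"
    and "wright_quasi_convex_coords a b c d f"
    and "\<And>x. x \<in> {a..b} \<Longrightarrow> (\<lambda>v. f (x, v)) absolutely_integrable_on {c..d}"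
    and "\<And>y. y \<in> {c..d} \<Longrightarrow> (\<lambda>u. f (u, y)) absolutely_integrable_on {a..b}"
    \<comment> \<open>the outer integral on the left-hand side exists; without this it may be \<open>-\<infinity>\<close>,
        for which the library's Bochner integral is \<open>0\<close> by convention\<close>
    and "(\<lambda>y. LINT x:{a..b}|lebesgue. f (x, y)) absolutely_integrable_on {c..d}"
  shows "1 / ((b - a) * (d - c)) * (LINT y:{c..d}|lebesgue. (LINT x:{a..b}|lebesgue. f (x, y)))
    \<le> 1 / 2 *
        (max (1 / (b - a) * (LINT x:{a..b}|lebesgue. f (x, c)))
             (1 / (b - a) * (LINT x:{a..b}|lebesgue. f (x, d)))
       + max (1 / (d - c) * (LINT y:{c..d}|lebesgue. f (a, y)))
             (1 / (d - c) * (LINT y:{c..d}|lebesgue. f (b, y))))"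
proof -
  note cols = assms(4) and rows = assms(5)
  have f: "sectionally_quasi_convex a b c d f"
    by (rule wright_imp_sectionally_quasi_convex[OF assms(3) cols rows])
  have ends: "a \<in> {a..b}" "b \<in> {a..b}" "c \<in> {c..d}" "d \<in> {c..d}" using assms(1,2) by auto
  define L where "L = (LINT y:{c..d}|lebesgue. (LINT x:{a..b}|lebesgue. f (x, y)))"
  define V where "V n x = (LINT v:{c..d}|lebesgue. cutoff n (f (x, v)))" for n x
  define H where "H n y = (LINT u:{a..b}|lebesgue. cutoff n (f (u, y)))" for n y
  define V' where "V' x = (LINT v:{c..d}|lebesgue. f (x, v))" for x
  define H' where "H' y = (LINT u:{a..b}|lebesgue. f (u, y))" for y
  have bound: "2 * L \<le> (b - a) * max (V n a) (V n b) + (d - c) * max (H n c) (H n d)" for n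
  proof -
    have "{a..b} \<times> {c..d} \<noteq> {}" using ends by auto
    then obtain p where p: "p \<in> {a..b} \<times> {c..d}" "\<And>q. q \<in> {a..b} \<times> {c..d} \<Longrightarrow> f p \<le> cutoff n (f q)"
      by (rule near_infimum_point[of _ f n]) blast
    obtain X Y where XY: "p = (X, Y)" by (rule prod.exhaust)
    have X: "X \<in> {a..b}" and Y: "Y \<in> {c..d}" using p(1) XY by auto
    \<comment> \<open>The level \<open>m = f p\<close> is below the cutoff of \<open>f\<close> on the whole rectangle.\<close>
    have lift: "max (f q) (f p) \<le> cutoff n (f q)" if "q \<in> {a..b} \<times> {c..d}" for q
    proof -
      have "f q \<le> f q + 1 / Suc n" by simp
      then have "f q \<le> cutoff n (f q)" unfolding cutoff_def by (rule max.coboundedI1)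
      then show ?thesis using p(2)[OF that] by simp
    qed
    have const: "(\<lambda>_::real. f p) absolutely_integrable_on {u..w}" for u w
      by (simp add: absolutely_integrable_on_const)
    have V: "(LINT v:{c..d}|lebesgue. max (f (x, v)) (f p)) \<le> V n x" if "x \<in> {a..b}" for x
      unfolding V_def using that
      by (intro set_integral_mono absolutely_integrable_max_1 cutoff_integral(1) cols const lift) auto
    have H: "(LINT u:{a..b}|lebesgue. max (f (u, y)) (f p)) \<le> H n y" if "y \<in> {c..d}" for y
      unfolding H_def using that
      by (intro set_integral_mono absolutely_integrable_max_1 cutoff_integral(1) rows const lift) auto
    have "2 * L \<le> (X - a) * (LINT v:{c..d}|lebesgue. max (f (a, v)) (f p)) + (b - X) * (LINT v:{c..d}|lebesgue. max (f (b, v)) (f p))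
      + ((Y - c) * (LINT u:{a..b}|lebesgue. max (f (u, c)) (f p)) + (d - Y) * (LINT u:{a..b}|lebesgue. max (f (u, d)) (f p)))"
      unfolding L_def using XY
      by (intro double_integral_le_weighted_sides[OF f X Y _ cols rows assms(6)]) auto
    also have "\<dots> \<le> (X - a) * V n a + (b - X) * V n b + ((Y - c) * H n c + (d - Y) * H n d)"
      using X Y by (intro add_mono mult_left_mono V H ends) auto
    also have "\<dots> \<le> ((X - a) + (b - X)) * max (V n a) (V n b) + ((Y - c) + (d - Y)) * max (H n c) (H n d)"
      using X Y by (intro add_mono weighted_le_max) auto
    finally show ?thesis by simp
  qed
  have lim: "(\<lambda>n. (b - a) * max (V n a) (V n b) + (d - c) * max (H n c) (H n d))
      \<longlonglongrightarrow> (b - a) * max (V' a) (V' b) + (d - c) * max (H' c) (H' d)"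
    unfolding V_def H_def V'_def H'_def
    by (intro tendsto_intros tendsto_max cutoff_integral(2) cols rows ends)
  have "2 * L \<le> (b - a) * max (V' a) (V' b) + (d - c) * max (H' c) (H' d)"
    using lim by (rule LIMSEQ_le_const) (use bound in blast)
  then have "2 * L / (2 * ((b - a) * (d - c)))
      \<le> ((b - a) * max (V' a) (V' b) + (d - c) * max (H' c) (H' d)) / (2 * ((b - a) * (d - c)))"
    using assms(1,2) by (intro divide_right_mono) auto
  also have "\<dots> = 1 / 2 * (1 / (b - a) * max (H' c) (H' d) + 1 / (d - c) * max (V' a) (V' b))"
    using assms(1,2) by (simp add: field_simps)
  also have "1 / (b - a) * max (H' c) (H' d) = max (1 / (b - a) * H' c) (1 / (b - a) * H' d)"
    using assms(1) by (intro max_mult_distrib_left[THEN trans]) auto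
  also have "1 / (d - c) * max (V' a) (V' b) = max (1 / (d - c) * V' a) (1 / (d - c) * V' b)"
    using assms(2) by (intro max_mult_distrib_left[THEN trans]) auto
  finally show ?thesis unfolding L_def V'_def H'_def by simp
qed

end
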